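(* Let $a$ and $x$ be parameters (indeterminates, or complex numbers for which no denominator below vanishes), and $|q|<1$. For $n\ge 0$ define $$\alpha_n'=\frac{q^{n^2-n}(-x)^n(1-a^2q^{4n})(a^2/x;q^2)_n}{(1-a^2)(q^2x;q^2)_n}\sum_{0\le j\le n}\frac{(1-aq^{2j-1})(a;q)_{j-1}(x;q^2)_j}{q^{j(j-1)/2}x^j(q;q)_j(a^2/x;q^2)_j},$$ $$\beta_n'=\frac{(-1)^nq^{n^2}(1-x)}{(-a;q)_{2n}(q^2;q^2)_n(1-xq^{2n})}.$$ Then $(\alpha_n',\beta_n')$ is a Bailey pair relative to $a^2$ with base $q^2$, i.e. for every $n\ge0$, $$\beta_n'=\sum_{i=0}^{n}\frac{\alpha_i'}{(q^2;q^2)_{n-i}(a^2q^2;q^2)_{n+i}}.$$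
   Context: Notation: $(z;p)_n=\prod_{k=0}^{n-1}(1-zp^k)$ for $n\ge0$, $(z;p)_\infty=\prod_{k\ge0}(1-zp^k)$, and $(z)_n=(z;q)_n$. The convention $(a;q)_{-1}=1/(1-aq^{-1})$ is used, so that the $j=0$ term of the inner sum equals $1$. A pair of sequences $(\alpha_n,\beta_n)$ is a Bailey pair relative to $A$ with base $p$ if $\beta_n=\sum_{i=0}^n \alpha_i/((p;p)_{n-i}(Ap;p)_{n+i})$ for all $n\ge0$. *)

theory Defs
  imports Complex_Main "HOL-Computational_Algebra.Polynomial_Factorial"
begin

definition qpoch :: "'k::field \<Rightarrow> 'k \<Rightarrow> nat \<Rightarrow> 'k" where
  "qpoch z p n = (\<Prod>k<n. 1 - z * p ^ k)"

text \<open>\<open>qpoch_pred z p j\<close> is $(z;p)_{j-1}$, with the convention $(z;p)_{-1} = 1/(1 - z p^{-1})$.\<close>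

definition qpoch_pred :: "'k::field \<Rightarrow> 'k \<Rightarrow> nat \<Rightarrow> 'k" where
  "qpoch_pred z p j = (case j of 0 \<Rightarrow> 1 / (1 - z * inverse p) | Suc m \<Rightarrow> qpoch z p m)"

definition bailey_pair :: "'k::field \<Rightarrow> 'k \<Rightarrow> (nat \<Rightarrow> 'k) \<Rightarrow> (nat \<Rightarrow> 'k) \<Rightarrow> bool" where
  "bailey_pair A p \<alpha> \<beta> \<longleftrightarrow>
     (\<forall>n. \<beta> n = (\<Sum>i=0..n. \<alpha> i / (qpoch p p (n - i) * qpoch (A * p) p (n + i))))"

definition alpha' :: "'k::field \<Rightarrow> 'k \<Rightarrow> 'k \<Rightarrow> nat \<Rightarrow> 'k" where
  "alpha' a x q n =
     q ^ (n\<^sup>2 - n) * (- x) ^ n * (1 - a\<^sup>2 * q ^ (4 * n)) * qpoch (a\<^sup>2 / x) (q\<^sup>2) n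
       / ((1 - a\<^sup>2) * qpoch (q\<^sup>2 * x) (q\<^sup>2) n)
     * (\<Sum>j=0..n. (1 - a * q powi (2 * int j - 1)) * qpoch_pred a q j * qpoch x (q\<^sup>2) j
          / (q ^ (j * (j - 1) div 2) * x ^ j * qpoch q q j * qpoch (a\<^sup>2 / x) (q\<^sup>2) j))"

definition beta' :: "'k::field \<Rightarrow> 'k \<Rightarrow> 'k \<Rightarrow> nat \<Rightarrow> 'k" where
  "beta' a x q n =
     (- 1) ^ n * q ^ n\<^sup>2 * (1 - x)
       / (qpoch (- a) q (2 * n) * qpoch (q\<^sup>2) (q\<^sup>2) n * (1 - x * q ^ (2 * n)))"

text \<open>
  The type \<open>complex poly poly fract\<close> is the field of rational functions over the complex numbers
  in two indeterminates: \<open>indet_a\<close> is the variable of the inner polynomial ring and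
  \<open>indet_x\<close> that of the outer one.
\<close>

definition const_ratfun :: "complex \<Rightarrow> complex poly poly fract" where
  "const_ratfun c = to_fract [:[:c:]:]"

definition indet_a :: "complex poly poly fract" where
  "indet_a = to_fract [:[:0, 1:]:]"

definition indet_x :: "complex poly poly fract" where
  "indet_x = to_fract [:0, 1:]"

end

theory Submission
  imports Defs
begin

text \<open>
  After interchanging the two summations, the sum over \<open>i \<ge> j\<close> is a terminating very-well-poised
  $_6\phi_5$ series in base $q^2$; one of its numerator parameters equals the base, so its tails
  have closed forms and the sum telescopes. What remains is, up to the factor $(1-x)/(1-xq^{2n})$,
  an identity free of \<open>x\<close>:
  $$\sum_{j=0}^n \frac{(-1)^j q^{j(j-1)/2}(1-aq^{2j-1})(a;q)_{j-1}}
      {(q;q)_j(q^2;q^2)_{n-j}(a^2;q^2)_{n+j}}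
    = \frac{(-1)^n q^{n^2}}{(-a;q)_{2n}(q^2;q^2)_n}.$$
  It is a limiting case of the terminating $_6\phi_5$ sum in base $q$. Both sides satisfy the same
  first-order recurrence in \<open>n\<close>, which for the left side follows from a WZ certificate.
\<close>

section \<open>q-Pochhammer symbols and quadratic exponents\<close>

lemma qpoch_0 [simp]: "qpoch z p 0 = 1"
  by (simp add: qpoch_def)

lemma qpoch_Suc: "qpoch z p (Suc n) = qpoch z p n * (1 - z * p ^ n)"
  by (simp add: qpoch_def)

lemma qpoch_Suc_shift: "qpoch z p (Suc n) = (1 - z) * qpoch (z * p) p n"
  by (simp add: qpoch_def prod.lessThan_Suc_shift mult.assoc del: prod.lessThan_Suc)

lemma qpoch_eq_0_iff: "qpoch z p n = 0 \<longleftrightarrow> (\<exists>k<n. z * p ^ k = 1)"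
  by (auto simp: qpoch_def)

text \<open>The convention for index -1 lets the usual recurrence start at \<open>j = 0\<close>,
  where it reads (a;q)_(-1) (1 - a/q) = 1.\<close>

lemma qpoch_pred_Suc:
  assumes "q \<noteq> 0" "1 - a * inverse q \<noteq> 0"
  shows "qpoch_pred a q (Suc j) = qpoch_pred a q j * (1 - a * q ^ j / q)"
  using assms by (cases j) (simp_all add: qpoch_pred_def qpoch_Suc divide_inverse mult.assoc)

lemma triangular_Suc: "Suc j * (Suc j - 1) div 2 = j * (j - 1) div 2 + j"
  by (metis choose_two One_nat_def Suc_1 add.commute binomial_Suc_Suc choose_one)

lemma square_diff_eq_triangular: "j\<^sup>2 - j = 2 * (j * (j - 1) div 2)" for j :: nat
  by (simp add: power2_eq_square diff_mult_distrib2)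

section \<open>Telescoping the inner sum\<close>

text \<open>With u = q^(2j) and v = q^(2(n-j)), this is the telescoping step of
  \<open>inner_sum\<close> stripped of common factors.\<close>

lemma inner_summand_step:
  fixes A x u v :: "'k::field"
  assumes "x \<noteq> 0" "1 - v \<noteq> 0" "1 - x * u * v \<noteq> 0"
  shows "(1 - A * u\<^sup>2) / (1 - v) - u * x * (1 - A / x * u) / (1 - x * u * v)
       = (1 - A * u\<^sup>2 * v) * (1 - x * u) / ((1 - v) * (1 - x * u * v))"
proof -
  have "(1 - A * u\<^sup>2) * (1 - x * u * v) - u * x * (1 - A / x * u) * (1 - v)
      = (1 - A * u\<^sup>2 * v) * (1 - x * u)"
    using assms(1) by (simp add: field_simps power2_eq_square)
  then show ?thesis
    using assms(2,3) by (simp add: diff_frac_eq mult_ac)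
qed

text \<open>Since \<open>?S j\<close> is a closed form for the tail, downward induction from
  \<open>j = n\<close> only has to check \<open>?t j + ?S (Suc j) = ?S j\<close>.\<close>

lemma inner_sum:
  fixes A x q :: "'k::field"
  assumes x: "x \<noteq> 0" and q: "\<And>k. k > 0 \<Longrightarrow> q ^ k \<noteq> 1"
    and xq: "\<And>k. x * (q\<^sup>2) ^ k \<noteq> 1"
    and A: "\<And>k. A * (q\<^sup>2) ^ k \<noteq> 1"
    and "j \<le> n"
  shows "(\<Sum>i=j..n. q ^ (i\<^sup>2 - i) * (- x) ^ i * (1 - A * q ^ (4 * i)) * qpoch (A / x) (q\<^sup>2) i * (1 - x)
            / (qpoch x (q\<^sup>2) (Suc i) * qpoch (q\<^sup>2) (q\<^sup>2) (n - i) * qpoch A (q\<^sup>2) (Suc (n + i))))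
       = q ^ (j\<^sup>2 - j) * (- x) ^ j * qpoch (A / x) (q\<^sup>2) j * (1 - x)
            / (qpoch x (q\<^sup>2) j * qpoch (q\<^sup>2) (q\<^sup>2) (n - j) * qpoch A (q\<^sup>2) (n + j)
                 * (1 - x * (q\<^sup>2) ^ n))"
    (is "sum ?t _ = ?S j")
  using \<open>j \<le> n\<close>
proof (induction j rule: inc_induct)
  case base
  \<comment> \<open>In the single term \<open>i = n\<close> the very-well-poised factor cancels the
    last factor of (A;q^2)_(2n+1).\<close>
  have "1 - A * q ^ (4 * n) = 1 - A * (q\<^sup>2) ^ (n + n)"
    by (simp flip: power_mult)
  with A[of "n + n"] show ?case
    by (simp add: qpoch_Suc divide_simps)
next
  case (step j)
  then obtain m where n: "n = Suc (j + m)"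
    using less_imp_Suc_add by blast
  define P where "P = q ^ (j\<^sup>2 - j) * (- x) ^ j * qpoch (A / x) (q\<^sup>2) j * (1 - x)"
  define X where "X = qpoch x (q\<^sup>2) j"
  define Q where "Q = qpoch (q\<^sup>2) (q\<^sup>2) m"
  define B where "B = qpoch A (q\<^sup>2) (n + j)"
  define u where "u = (q\<^sup>2) ^ j"
  define v where "v = (q\<^sup>2) ^ Suc m"
  have q4: "q ^ (4 * j) = u\<^sup>2"
    unfolding u_def power_mult[symmetric] by (simp add: mult_ac)
  have qn: "(q\<^sup>2) ^ n = u * v"
    by (simp only: n u_def v_def power_add power_Suc mult_ac)
  have "(q\<^sup>2) ^ (n + j) = u\<^sup>2 * v"
    unfolding power_add qn by (simp add: u_def power2_eq_square)
  note pow = q4 qn this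
  have quad: "q ^ ((Suc j)\<^sup>2 - Suc j) = q ^ (j\<^sup>2 - j) * u"
    by (simp only: square_diff_eq_triangular triangular_Suc)
      (simp add: u_def distrib_left power_add power_mult)
  have nz: "1 - x * u \<noteq> 0" "1 - x * u * v \<noteq> 0" "1 - A * u\<^sup>2 * v \<noteq> 0" "1 - v \<noteq> 0"
    using xq[of j] xq[of n] A[of "n + j"] q[of "2 * Suc m"]
    unfolding pow power_mult u_def[symmetric] v_def[symmetric] by (auto simp: mult.assoc)
  have nmj: "n - j = Suc m" "n - Suc j = m"
    using n by auto
  have t: "?t j = P * (1 - A * u\<^sup>2)
      / (X * (1 - x * u) * (Q * (1 - v)) * (B * (1 - A * u\<^sup>2 * v)))"
    by (simp add: qpoch_Suc nmj pow P_def X_def Q_def B_def mult.assoc)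
      (simp add: u_def v_def mult_ac)
  have S1: "?S (Suc j) = P * u * (- x) * (1 - A / x * u)
      / (X * (1 - x * u) * Q * (B * (1 - A * u\<^sup>2 * v)) * (1 - x * u * v))"
    by (simp only: qpoch_Suc nmj pow P_def X_def Q_def B_def quad add_Suc_right power_Suc)
      (simp add: u_def mult_ac)
  have S0: "?S j = P / (X * (Q * (1 - v)) * B * (1 - x * u * v))"
    by (simp add: qpoch_Suc nmj pow P_def X_def Q_def B_def mult.assoc)
      (simp add: u_def v_def mult_ac)
  \<comment> \<open>\<open>R\<close> is the common factor of \<open>?t j\<close> and
    \<open>?S (Suc j)\<close>; what remains is the left side of
    \<open>inner_summand_step\<close>.\<close>
  define R where "R = P / (X * (1 - x * u) * Q * (B * (1 - A * u\<^sup>2 * v)))"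
  have "sum ?t {j..n} = ?t j + ?S (Suc j)"
    using step by (simp add: sum.atLeast_Suc_atMost)
  also have "\<dots> = R * ((1 - A * u\<^sup>2) / (1 - v) - u * x * (1 - A / x * u) / (1 - x * u * v))"
    unfolding t S1 right_diff_distrib[of R] by (simp add: R_def mult_ac)
  also have "\<dots> = R * ((1 - A * u\<^sup>2 * v) * (1 - x * u) / ((1 - v) * (1 - x * u * v)))"
    using inner_summand_step[OF x nz(4,2)] by simp
  also have "\<dots> = ?S j"
    unfolding S0 R_def using nz by simp
  finally show ?case .
qed

section \<open>The sum free of x: WZ certificate and recurrence\<close>

text \<open>
  Obtained by solving the linear system for the coefficients of a Laurent polynomial in \<open>q ^ j\<close>.
\<close>

definition certificate :: "'k::field \<Rightarrow> 'k \<Rightarrow> nat \<Rightarrow> nat \<Rightarrow> 'k" where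
  "certificate a q n j = 1 + a * q ^ (2 * n) * (1 + q ^ j) + q ^ (2 * n + 2 - j)"

text \<open>
  Here \<open>b = a / q\<close>, \<open>y = q ^ j\<close> and \<open>w * y\<^sup>2 = q ^ (2 * n)\<close>, which makes \<open>certificate_identity\<close>
  polynomial.
\<close>

lemma certificate_polynomial_identity:
  fixes b q w y :: "'k::comm_ring_1"
  shows "(1 - b * y\<^sup>2) * ((1 + b * q * (w * y\<^sup>2)) * (1 + b * q\<^sup>2 * (w * y\<^sup>2)) * (1 - q\<^sup>2 * (w * y\<^sup>2))
            + q * (w * y\<^sup>2) * (1 - q\<^sup>2 * w) * (1 - b\<^sup>2 * q\<^sup>2 * (w * y\<^sup>2) * y\<^sup>2))
       = y * (1 - b * y) * (1 - q\<^sup>2 * w) * (1 + b * q * (w * y\<^sup>2) * (1 + q * y) + q * w * y)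
         + (1 - y) * (1 - b\<^sup>2 * q\<^sup>2 * (w * y\<^sup>2) * y\<^sup>2) * (1 + b * q * (w * y\<^sup>2) * (1 + y) + q\<^sup>2 * w * y)"
  by (simp add: algebra_simps power2_eq_square)

text \<open>This is the WZ equation divided by the factor \<open>D j\<close> of
  \<open>outer_partial_sum\<close>: the left side comes from the recurrence in n, the right side
  from a difference in j. The bound on j keeps every natural subtraction exact.\<close>

lemma certificate_identity:
  fixes a q :: "'k::field"
  assumes q: "q \<noteq> 0" and j: "j \<le> Suc n"
  shows "(1 - a * q ^ (2 * j) / q) *
           ((1 + a * q ^ (2 * n)) * (1 + a * q ^ (2 * n + 1)) * (1 - q ^ (2 * n + 2))
             + q ^ (2 * n + 1) * (1 - (q\<^sup>2) ^ (Suc n - j)) * (1 - a\<^sup>2 * (q\<^sup>2) ^ (n + j)))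
       = q ^ j * (1 - a * q ^ j / q) * (1 - (q\<^sup>2) ^ (Suc n - j)) * certificate a q n (Suc j)
         + (1 - q ^ j) * (1 - a\<^sup>2 * (q\<^sup>2) ^ (n + j)) * certificate a q n j"
proof -
  obtain m where m: "Suc n = j + m"
    using j le_Suc_ex by blast
  define b where "b = a / q"
  define y where "y = q ^ j"
  \<comment> \<open>For \<open>j = Suc n\<close> we have \<open>m = 0\<close>, and w is then q^(-2);
    hence the division.\<close>
  define w where "w = (q\<^sup>2) ^ m / q\<^sup>2"
  have a: "a = b * q"
    using q by (simp add: b_def)
  have "q\<^sup>2 * q ^ (2 * n) = q ^ (2 * (j + m))"
    by (simp flip: m power_add)
  then have N: "q ^ (2 * n) = w * y\<^sup>2"
    using q by (simp add: w_def y_def field_simps power_add power_mult flip: power_mult_distrib)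
      (simp add: power2_eq_square power_mult_distrib)
  have y2: "q ^ (2 * j) = y\<^sup>2"
    by (simp add: y_def mult.commute flip: power_mult)
  have v: "(q\<^sup>2) ^ (Suc n - j) = q\<^sup>2 * w"
    using q by (simp add: m w_def)
  have A: "a\<^sup>2 * (q\<^sup>2) ^ (n + j) = b\<^sup>2 * q\<^sup>2 * (w * y\<^sup>2) * y\<^sup>2"
    by (simp add: a power_mult_distrib power_add N y2 flip: power_mult)
  have "2 * n + 2 - j = 2 * m + j" "2 * n + 2 - Suc j + 1 = 2 * m + j"
    using m j by auto
  then have e1: "q ^ (2 * n + 2 - j) = q\<^sup>2 * w * y"
    and "q ^ (2 * n + 2 - Suc j) * q = q\<^sup>2 * w * y"
    using q by (simp_all add: w_def y_def power_add power_mult flip: power_Suc2)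
  then have e2: "q ^ (2 * n + 2 - Suc j) = q * w * y"
    using q by (simp add: power2_eq_square)
  show ?thesis
    using certificate_polynomial_identity[of b y q w] q
    unfolding certificate_def e1 e2 A v y2
    unfolding power_add N
    by (simp add: a power2_eq_square mult_ac flip: y_def)
qed

text \<open>\<open>D j\<close> is the summand at level \<open>Suc n\<close> without its factor 1 - a
  q^(2j-1); the two factors next to \<open>q ^ (2 * n + 1)\<close> lower it to level n. By
  \<open>certificate_identity\<close> the sum telescopes to its upper boundary term, the lower one
  having the factor 1 - q^0 = 0.\<close>

lemma outer_partial_sum:
  fixes a q :: "'k::field"
  assumes q0: "q \<noteq> 0" and q: "\<And>k. k > 0 \<Longrightarrow> q ^ k \<noteq> 1"
    and aq: "1 - a * inverse q \<noteq> 0"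
    and A: "\<And>k. a\<^sup>2 * (q\<^sup>2) ^ k \<noteq> 1"
    and "m \<le> Suc n"
  defines "D \<equiv> \<lambda>j. (-1) ^ j * q ^ (j * (j - 1) div 2) * qpoch_pred a q j
      / (qpoch q q j * qpoch (q\<^sup>2) (q\<^sup>2) (Suc n - j) * qpoch (a\<^sup>2) (q\<^sup>2) (Suc (n + j)))"
  shows "(\<Sum>j\<le>m. D j * ((1 - a * q ^ (2 * j) / q) *
           ((1 + a * q ^ (2 * n)) * (1 + a * q ^ (2 * n + 1)) * (1 - q ^ (2 * n + 2))
             + q ^ (2 * n + 1) * (1 - (q\<^sup>2) ^ (Suc n - j)) * (1 - a\<^sup>2 * (q\<^sup>2) ^ (n + j)))))
       = D m * (q ^ m * (1 - a * q ^ m / q) * (1 - (q\<^sup>2) ^ (Suc n - m)) * certificate a q n (Suc m))"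
  using \<open>m \<le> Suc n\<close>
proof (induction m)
  case 0
  show ?case
    by (simp only: atMost_0 sum.insert sum.empty finite.emptyI empty_iff not_False_eq_True
        certificate_identity[OF q0 le0]) simp
next
  case (Suc m)
  then obtain k where n: "n = m + k"
    using le_Suc_ex by auto
  have "(q\<^sup>2) ^ l \<noteq> 1" if "l > 0" for l
    using q[of "2 * l"] that by (simp add: power_mult)
  from this[of "Suc k"] q[of "Suc m"]
  have nz: "1 - q * q ^ m \<noteq> 0" "1 - q\<^sup>2 * (q\<^sup>2) ^ k \<noteq> 0" "1 - a\<^sup>2 * (q\<^sup>2) ^ Suc (n + m) \<noteq> 0"
    using A[of "Suc (n + m)"] by auto
  have nm: "Suc n - m = Suc k" "Suc n - Suc m = k"
    using n by auto
  \<comment> \<open>The upper boundary term at \<open>m\<close> cancels the lower one at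
    \<open>Suc m\<close>; both carry \<open>certificate a q n (Suc m)\<close>.\<close>
  have D: "D m * (q ^ m * (1 - a * q ^ m / q) * (1 - (q\<^sup>2) ^ (Suc n - m)))
      = - (D (Suc m) * ((1 - q ^ Suc m) * (1 - a\<^sup>2 * (q\<^sup>2) ^ (n + Suc m))))"
    unfolding D_def nm triangular_Suc qpoch_pred_Suc[OF q0 aq] add_Suc_right
      qpoch_Suc[of q q m] qpoch_Suc[of "q\<^sup>2" "q\<^sup>2" k] qpoch_Suc[of "a\<^sup>2" "q\<^sup>2" "Suc (n + m)"]
    using nz by (simp add: power_add)
  show ?case
    unfolding sum.atMost_Suc Suc.IH[OF Suc_leD[OF Suc.prems]]
      certificate_identity[OF q0 Suc.prems]
    unfolding mult.assoc[symmetric] D[unfolded mult.assoc[symmetric]]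
    by (simp add: distrib_left mult.assoc)
qed

text \<open>With S(n) for the left side, induction rests on K S(n+1) = -q^(2n+1) S(n), where K is
  nonzero; S(0) = 1 by the convention for (a;q)_(-1).\<close>

lemma outer_sum:
  fixes a q :: "'k::field"
  assumes q0: "q \<noteq> 0" and q: "\<And>k. k > 0 \<Longrightarrow> q ^ k \<noteq> 1"
    and aq: "1 - a * inverse q \<noteq> 0"
    and A: "\<And>k. a\<^sup>2 * (q\<^sup>2) ^ k \<noteq> 1"
    and ma: "\<And>k. - a * q ^ k \<noteq> 1"
  shows "(\<Sum>j\<le>n. (-1) ^ j * q ^ (j * (j - 1) div 2) * qpoch_pred a q j * (1 - a * q ^ (2 * j) / q)
           / (qpoch q q j * qpoch (q\<^sup>2) (q\<^sup>2) (n - j) * qpoch (a\<^sup>2) (q\<^sup>2) (n + j)))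
       = (-1) ^ n * q ^ n\<^sup>2 / (qpoch (- a) q (2 * n) * qpoch (q\<^sup>2) (q\<^sup>2) n)"
proof (induction n)
  case 0
  show ?case
    using q0 aq by (simp add: qpoch_pred_def divide_inverse)
next
  case (Suc n)
  define c where "c j = (-1) ^ j * q ^ (j * (j - 1) div 2) * qpoch_pred a q j
    * (1 - a * q ^ (2 * j) / q)" for j
  define f where "f n j = c j
    / (qpoch q q j * qpoch (q\<^sup>2) (q\<^sup>2) (n - j) * qpoch (a\<^sup>2) (q\<^sup>2) (n + j))" for n j
  define r where "r n = (-1) ^ n * q ^ n\<^sup>2 / (qpoch (- a) q (2 * n) * qpoch (q\<^sup>2) (q\<^sup>2) n)" for n
  \<comment> \<open>\<open>K\<close> is the product of the denominator factors that \<open>r\<close>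
    gains from n to \<open>Suc n\<close>.\<close>
  define K where "K = (1 + a * q ^ (2 * n)) * (1 + a * q ^ (2 * n + 1)) * (1 - q ^ (2 * n + 2))"
  have Kfac: "1 + a * q ^ (2 * n) \<noteq> 0" "1 + a * q ^ (2 * n + 1) \<noteq> 0" "1 - q ^ (2 * n + 2) \<noteq> 0"
    using ma[of "2 * n"] ma[of "2 * n + 1"] q[of "2 * n + 2"]
    by (auto simp: add_eq_0_iff2 simp flip: minus_mult_left)
  have summand: "f n j * q ^ (2 * n + 1) = f (Suc n) j *
      (q ^ (2 * n + 1) * (1 - (q\<^sup>2) ^ (Suc n - j)) * (1 - a\<^sup>2 * (q\<^sup>2) ^ (n + j)))"
    if "j \<le> n" for j
  proof -
    have "(q\<^sup>2) ^ l \<noteq> 1" if "l > 0" for l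
      using q[of "2 * l"] that by (simp add: power_mult)
    from this[of "Suc (n - j)"] show ?thesis
      using that A[of "n + j"] by (simp add: f_def Suc_diff_le qpoch_Suc)
  qed
  \<comment> \<open>At \<open>m = Suc n\<close> the boundary term contains 1 - (q^2)^0 = 0.\<close>
  have "(\<Sum>j\<le>Suc n. f (Suc n) j *
        (K + q ^ (2 * n + 1) * (1 - (q\<^sup>2) ^ (Suc n - j)) * (1 - a\<^sup>2 * (q\<^sup>2) ^ (n + j)))) = 0"
    using outer_partial_sum[OF q0 q aq A order_refl, of n]
    by (simp add: f_def c_def K_def mult_ac del: sum.atMost_Suc)
  then have "0 = (\<Sum>j\<le>Suc n. f (Suc n) j) * K + (\<Sum>j\<le>Suc n. f (Suc n) j *
        (q ^ (2 * n + 1) * (1 - (q\<^sup>2) ^ (Suc n - j)) * (1 - a\<^sup>2 * (q\<^sup>2) ^ (n + j))))"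
    by (simp only: distrib_left sum.distrib sum_distrib_right)
  \<comment> \<open>The same zero factor removes the term \<open>j = Suc n\<close>, so that
    \<open>summand\<close> covers the remaining range.\<close>
  also have "(\<Sum>j\<le>Suc n. f (Suc n) j *
        (q ^ (2 * n + 1) * (1 - (q\<^sup>2) ^ (Suc n - j)) * (1 - a\<^sup>2 * (q\<^sup>2) ^ (n + j))))
      = (\<Sum>j\<le>n. f (Suc n) j *
        (q ^ (2 * n + 1) * (1 - (q\<^sup>2) ^ (Suc n - j)) * (1 - a\<^sup>2 * (q\<^sup>2) ^ (n + j))))"
    by simp
  also have "\<dots> = (\<Sum>j\<le>n. f n j * q ^ (2 * n + 1))"
    by (intro sum.cong refl summand[symmetric]) simp
  also have "\<dots> = r n * q ^ (2 * n + 1)"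
    unfolding sum_distrib_right[symmetric] f_def c_def r_def Suc.IH ..
  finally have "(\<Sum>j\<le>Suc n. f (Suc n) j) * K = - (r n * q ^ (2 * n + 1))"
    by (simp add: eq_neg_iff_add_eq_0)
  also have "r n * q ^ (2 * n + 1) = - (r (Suc n) * K)"
  proof -
    have sq: "(Suc n)\<^sup>2 = n\<^sup>2 + (2 * n + 1)"
      by (simp add: power2_eq_square)
    have q2: "q ^ (2 * n + 2) = q\<^sup>2 * (q\<^sup>2) ^ n"
      unfolding power_add power_mult by (rule mult.commute)
    have qp: "qpoch (- a) q (2 * Suc n)
        = qpoch (- a) q (2 * n) * (1 + a * q ^ (2 * n)) * (1 + a * q ^ (2 * n + 1))"
      "qpoch (q\<^sup>2) (q\<^sup>2) (Suc n) = qpoch (q\<^sup>2) (q\<^sup>2) n * (1 - q ^ (2 * n + 2))"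
      by (simp_all add: qpoch_Suc q2 del: add_2_eq_Suc')
    show ?thesis
      unfolding r_def qp sq K_def using Kfac by (simp add: power_add)
  qed
  finally have "(\<Sum>j\<le>Suc n. f (Suc n) j) = r (Suc n)"
    using Kfac by (simp add: K_def del: sum.atMost_Suc)
  then show ?case
    by (simp only: f_def c_def r_def)
qed

section \<open>Interchange of summations and the Bailey pair over a field\<close>

lemma sum_triangle_swap:
  fixes f :: "nat \<Rightarrow> nat \<Rightarrow> 'a::comm_monoid_add"
  shows "(\<Sum>i=0..n. \<Sum>j=0..i. f i j) = (\<Sum>j=0..n. \<Sum>i=j..n. f i j)"
  by (induction n) (simp_all add: sum.distrib add_ac)

text \<open>An arbitrary field makes complex parameters and indeterminates two instances of one
  statement.\<close>

theorem bailey_pair_alpha'_beta':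
  fixes a x q :: "'k::field"
  assumes q0: "q \<noteq> 0" and q: "\<And>k. k > 0 \<Longrightarrow> q ^ k \<noteq> 1"
    and x: "x \<noteq> 0"
    and aq: "1 - a * inverse q \<noteq> 0"
    and A: "\<And>k. a\<^sup>2 * (q\<^sup>2) ^ k \<noteq> 1"
    and ma: "\<And>k. - a * q ^ k \<noteq> 1"
    and xq: "\<And>k. x * (q\<^sup>2) ^ k \<noteq> 1"
    and Ax: "\<And>k. a\<^sup>2 / x * (q\<^sup>2) ^ k \<noteq> 1"
  shows "bailey_pair (a\<^sup>2) (q\<^sup>2) (alpha' a x q) (beta' a x q)"
  unfolding bailey_pair_def
proof
  fix n
  define p where "p = q\<^sup>2"
  define c where "c j = (1 - a * q powi (2 * int j - 1)) * qpoch_pred a q j * qpoch x p j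
          / (q ^ (j * (j - 1) div 2) * x ^ j * qpoch q q j * qpoch (a\<^sup>2 / x) p j)" for j
  define t where "t i = q ^ (i\<^sup>2 - i) * (- x) ^ i * (1 - a\<^sup>2 * q ^ (4 * i)) * qpoch (a\<^sup>2 / x) p i * (1 - x)
            / (qpoch x p (Suc i) * qpoch p p (n - i) * qpoch (a\<^sup>2) p (Suc (n + i)))" for i
  have x1: "1 - x \<noteq> 0"
    using xq[of 0] by simp
  \<comment> \<open>Here (1 - a^2)(a^2 q^2;q^2)_(n+i) = (a^2;q^2)_(n+i+1) and (1 - x)(q^2 x;q^2)_i =
    (x;q^2)_(i+1), whence the numerator factor \<open>1 - x\<close> in \<open>t i\<close>.\<close>
  have alpha: "alpha' a x q i / (qpoch p p (n - i) * qpoch (a\<^sup>2 * p) p (n + i)) = (\<Sum>j=0..i. t i * c j)" for i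
    unfolding alpha'_def p_def[symmetric] c_def[symmetric] t_def qpoch_Suc_shift sum_distrib_left[symmetric]
    using x1 by (simp add: mult_ac)
  have "(\<Sum>i=0..n. alpha' a x q i / (qpoch p p (n - i) * qpoch (a\<^sup>2 * p) p (n + i)))
      = (\<Sum>j=0..n. \<Sum>i=j..n. t i * c j)"
    unfolding alpha by (rule sum_triangle_swap)
  also have "\<dots> = (\<Sum>j=0..n. (q ^ (j\<^sup>2 - j) * (- x) ^ j * qpoch (a\<^sup>2 / x) p j * (1 - x)
            / (qpoch x p j * qpoch p p (n - j) * qpoch (a\<^sup>2) p (n + j) * (1 - x * p ^ n))) * c j)"
    unfolding sum_distrib_right[symmetric] t_def p_def
    by (intro sum.cong refl arg_cong2[of _ _ _ _ "(*)"] inner_sum[OF x q xq A]) simp_all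
  also have "\<dots> = (\<Sum>j=0..n. (1 - x) / (1 - x * p ^ n) *
      ((-1) ^ j * q ^ (j * (j - 1) div 2) * qpoch_pred a q j * (1 - a * q ^ (2 * j) / q)
           / (qpoch q q j * qpoch p p (n - j) * qpoch (a\<^sup>2) p (n + j))))"
  proof (intro sum.cong refl)
    \<comment> \<open>Multiplying by \<open>c j\<close> cancels both Pochhammer symbols containing
      x, the power x^j and half of the exponent j^2 - j; x survives only in the prefactor.\<close>
    fix j
    have nz: "qpoch x p j \<noteq> 0" "qpoch (a\<^sup>2 / x) p j \<noteq> 0"
      using xq Ax by (auto simp: qpoch_eq_0_iff p_def)
    \<comment> \<open>The quotient form also covers \<open>j = 0\<close>, where the exponent is
      -1.\<close>
    have e: "q powi (2 * int j - 1) = q ^ (2 * j) / q"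
      using q0 power_int_diff[of q "2 * int j" 1] by (simp add: power_int_def nat_mult_distrib)
    have s: "q ^ (j\<^sup>2 - j) = q ^ (j * (j - 1) div 2) * q ^ (j * (j - 1) div 2)"
      by (simp only: square_diff_eq_triangular mult_2 power_add)
    have mx: "(- x) ^ j = (-1) ^ j * x ^ j"
      by (rule power_minus)
    show "(q ^ (j\<^sup>2 - j) * (- x) ^ j * qpoch (a\<^sup>2 / x) p j * (1 - x)
            / (qpoch x p j * qpoch p p (n - j) * qpoch (a\<^sup>2) p (n + j) * (1 - x * p ^ n))) * c j
      = (1 - x) / (1 - x * p ^ n) *
      ((-1) ^ j * q ^ (j * (j - 1) div 2) * qpoch_pred a q j * (1 - a * q ^ (2 * j) / q)
           / (qpoch q q j * qpoch p p (n - j) * qpoch (a\<^sup>2) p (n + j)))"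
      unfolding c_def e s mx using nz x q0 by (simp add: mult_ac)
  qed
  also have "\<dots> = beta' a x q n"
    using outer_sum[OF q0 q aq A ma, of n] unfolding sum_distrib_left[symmetric] atMost_atLeast0 p_def
    by (simp add: beta'_def mult_ac flip: power_mult)
  finally show "beta' a x q n
      = (\<Sum>i=0..n. alpha' a x q i / (qpoch (q\<^sup>2) (q\<^sup>2) (n - i) * qpoch (a\<^sup>2 * q\<^sup>2) (q\<^sup>2) (n + i)))"
    by (simp add: p_def)
qed

section \<open>Specialization to complex numbers and to two indeterminates\<close>

lemma const_ratfun_power: "const_ratfun c ^ k = const_ratfun (c ^ k)"
  by (induction k) (simp_all add: const_ratfun_def one_pCons flip: to_fract_mult to_fract_1)

lemma const_ratfun_inject: "const_ratfun c = const_ratfun d \<longleftrightarrow> c = d"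
  by (simp add: const_ratfun_def)

lemma const_ratfun_0: "const_ratfun 0 = 0" and const_ratfun_1: "const_ratfun 1 = 1"
  by (simp_all add: const_ratfun_def flip: one_pCons)

text \<open>Injectivity of \<open>to_fract\<close> reduces each claim to comparing coefficients of
  polynomials. In the application \<open>c\<close> is a power of q; the last claim is the condition
  on a^2/x multiplied through by x.\<close>

lemma indet_generic:
  shows "indet_x \<noteq> 0"
    and "indet_a \<noteq> const_ratfun c"
    and "indet_a\<^sup>2 * const_ratfun c \<noteq> 1"
    and "- indet_a * const_ratfun c \<noteq> 1"
    and "indet_x * const_ratfun c \<noteq> 1"
    and "indet_a\<^sup>2 * const_ratfun c \<noteq> indet_x"
  unfolding indet_a_def indet_x_def const_ratfun_def power2_eq_square
    to_fract_mult[symmetric] to_fract_uminus[symmetric] to_fract_1[symmetric] to_fract_0[symmetric]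
    to_fract_eq_iff
  by (auto simp: one_pCons)

theorem theorem2p1:
  fixes q :: complex
  assumes "norm q < 1" and "q \<noteq> 0"
  shows
    "(\<forall>a x :: complex.
        x \<noteq> 0 \<longrightarrow>
        1 - a\<^sup>2 \<noteq> 0 \<longrightarrow>
        1 - a * inverse q \<noteq> 0 \<longrightarrow>
        (\<forall>n. qpoch (q\<^sup>2 * x) (q\<^sup>2) n \<noteq> 0) \<longrightarrow>
        (\<forall>n. qpoch (a\<^sup>2 / x) (q\<^sup>2) n \<noteq> 0) \<longrightarrow>
        (\<forall>n. qpoch (- a) q (2 * n) \<noteq> 0) \<longrightarrow>
        (\<forall>n. 1 - x * q ^ (2 * n) \<noteq> 0) \<longrightarrow>
        (\<forall>n. qpoch (a\<^sup>2 * q\<^sup>2) (q\<^sup>2) n \<noteq> 0) \<longrightarrow>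
        bailey_pair (a\<^sup>2) (q\<^sup>2) (alpha' a x q) (beta' a x q)) \<and>
     bailey_pair (indet_a\<^sup>2) ((const_ratfun q)\<^sup>2)
       (alpha' indet_a indet_x (const_ratfun q)) (beta' indet_a indet_x (const_ratfun q))"
proof (intro conjI allI impI)
  have q: "q ^ k \<noteq> 1" if "k > 0" for k
    using power_eq_1_iff[of q k] assms(1) that by auto
  {
    fix a x :: complex
    assume x: "x \<noteq> 0" and a: "1 - a\<^sup>2 \<noteq> 0" and aq: "1 - a * inverse q \<noteq> 0"
      and Ax: "\<forall>n. qpoch (a\<^sup>2 / x) (q\<^sup>2) n \<noteq> 0"
      and ma: "\<forall>n. qpoch (- a) q (2 * n) \<noteq> 0"
      and xq: "\<forall>n. 1 - x * q ^ (2 * n) \<noteq> 0"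
      and A: "\<forall>n. qpoch (a\<^sup>2 * q\<^sup>2) (q\<^sup>2) n \<noteq> 0"
    show "bailey_pair (a\<^sup>2) (q\<^sup>2) (alpha' a x q) (beta' a x q)"
    proof (rule bailey_pair_alpha'_beta'[OF assms(2) q x aq])
      fix k
      \<comment> \<open>The case \<open>k = 0\<close> is the hypothesis on 1 - a^2; otherwise this
        is the last factor of (a^2 q^2;q^2)_k.\<close>
      show "a\<^sup>2 * (q\<^sup>2) ^ k \<noteq> 1"
        using a A[rule_format, of k] by (cases k) (auto simp: qpoch_Suc mult.assoc)
      show "- a * q ^ k \<noteq> 1"
        using ma[rule_format, of "Suc k"] unfolding qpoch_eq_0_iff by auto
      show "x * (q\<^sup>2) ^ k \<noteq> 1"
        using xq[rule_format, of k] by (simp add: power_mult)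
      show "a\<^sup>2 / x * (q\<^sup>2) ^ k \<noteq> 1"
        using Ax[rule_format, of "Suc k"] unfolding qpoch_eq_0_iff by auto
    qed
  }
  show "bailey_pair (indet_a\<^sup>2) ((const_ratfun q)\<^sup>2)
       (alpha' indet_a indet_x (const_ratfun q)) (beta' indet_a indet_x (const_ratfun q))"
  proof (rule bailey_pair_alpha'_beta')
    show Q0: "const_ratfun q \<noteq> 0"
      using assms(2) by (metis const_ratfun_0 const_ratfun_inject)
    show "1 - indet_a * inverse (const_ratfun q) \<noteq> 0"
      using indet_generic(2)[of q] Q0 by (simp add: field_simps)
    show "const_ratfun q ^ k \<noteq> 1" if "k > 0" for k
      unfolding const_ratfun_power using q[OF that] by (metis const_ratfun_1 const_ratfun_inject)
    show "indet_a\<^sup>2 / indet_x * ((const_ratfun q)\<^sup>2) ^ k \<noteq> 1" for k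
      unfolding const_ratfun_power using indet_generic(1) indet_generic(6)[of "(q\<^sup>2) ^ k"]
      by (simp add: field_simps)
  qed (simp_all only: const_ratfun_power indet_generic not_False_eq_True)
qed

end
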